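(* Let $G=(N,E,w)$ be a cycle-free weighted graph. Then the $\tilde{\mathcal{P}}_{\min}$-restricted game $(N,\hat v)$ is convex for every convex game $(N,v)$ if and only if the Star condition and the Path condition are satisfied by $G$.
   Context: $G=(N,E,w)$ is a finite simple undirected graph with vertex set $N$, edge set $E$ and weight function $w:E\to\mathbb{R}$; $w_k$ denotes $w(e_k)$. Cycle-free means that $G$ contains no cycle. A game is a pair $(N,v)$ with $v:2^N\to\mathbb{R}$, $v(\emptyset)=0$. It is convex if $v(A\cup B)+v(A\cap B)\ge v(A)+v(B)$ for all $A,B\subseteq N$. For $A\subseteq N$, $E(A)$ is the set of edges with both ends in $A$, $G_A=(A,E(A))$, and $\Sigma(A)$ is the set of minimum weight edges in $E(A)$ (empty if $E(A)=\emptyset$). $\mathcal{P}_{\min}(A)$ is the partition of $A$ into the connected components of $(A,E(A)\setminus\Sigma(A))$. If $A_1,\dots,A_p$ are the connected components of $G_A$, then $\tilde{\mathcal{P}}_{\min}(A)$ is the partition of $A$ whose blocks are all the blocks of $\mathcal{P}_{\min}(A_1),\dots,\mathcal{P}_{\min}(A_p)$. The $\tilde{\mathcal{P}}_{\min}$-restricted game of $(N,v)$ is $\hat v(A)=\sum_{F\in\tilde{\mathcal{P}}_{\min}(A)}v(F)$, $A\subseteq N$. **Star condition.** For any three distinct edges $e_1,e_2,e_3$ incident to a common vertex, after renumbering these edges, $w_1\le w_2=w_3$. **Path condition.** For every path $\{1,e_1,2,e_2,\dots,m,e_m,m+1\}$ in $G$ (with distinct vertices) and all $1\le i<j<k\le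 m$: $w_j\le\max(w_i,w_k)$. *)

theory Defs
  imports Complex_Main
begin

section \<open>Weighted graphs\<close>

text \<open>
  An undirected simple graph is a vertex set \<open>N\<close> together with a set \<open>E\<close> of edges, each edge
  being the two-element set of its ends. Weights are given by a total function on vertex sets;
  only its values on \<open>E\<close> are ever used.
\<close>

definition finite_simple_graph :: "'a set \<Rightarrow> 'a set set \<Rightarrow> bool" where
  "finite_simple_graph N E \<longleftrightarrow> finite N \<and> (\<forall>e\<in>E. e \<subseteq> N \<and> card e = 2)"

text \<open>The edges of a path \<open>p\<close> are \<open>path_edge p i\<close> for \<open>Suc i < length p\<close>, counted from 0.\<close>

definition path_edge :: "'a list \<Rightarrow> nat \<Rightarrow> 'a set" where
  "path_edge p i = {p ! i, p ! Suc i}"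

definition is_path :: "'a set \<Rightarrow> 'a set set \<Rightarrow> 'a list \<Rightarrow> bool" where
  "is_path N E p \<longleftrightarrow>
     p \<noteq> [] \<and> distinct p \<and> set p \<subseteq> N \<and> (\<forall>i. Suc i < length p \<longrightarrow> path_edge p i \<in> E)"

definition is_cycle :: "'a set \<Rightarrow> 'a set set \<Rightarrow> 'a list \<Rightarrow> bool" where
  "is_cycle N E c \<longleftrightarrow> is_path N E c \<and> 3 \<le> length c \<and> {last c, hd c} \<in> E"

definition cycle_free :: "'a set \<Rightarrow> 'a set set \<Rightarrow> bool" where
  "cycle_free N E \<longleftrightarrow> (\<nexists>c. is_cycle N E c)"

definition connected_rel :: "'a set \<Rightarrow> 'a set set \<Rightarrow> ('a \<times> 'a) set" where
  "connected_rel A F =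
     {(x, y). x \<in> A \<and> y \<in> A \<and> (x, y) \<in> {(u, u'). u \<in> A \<and> u' \<in> A \<and> {u, u'} \<in> F}\<^sup>*}"

definition components :: "'a set \<Rightarrow> 'a set set \<Rightarrow> 'a set set" where
  "components A F = A // connected_rel A F"

definition induced_edges :: "'a set set \<Rightarrow> 'a set \<Rightarrow> 'a set set" where
  "induced_edges E A = {e \<in> E. e \<subseteq> A}"

definition min_edges :: "'a set set \<Rightarrow> ('a set \<Rightarrow> real) \<Rightarrow> 'a set \<Rightarrow> 'a set set" where
  "min_edges E w A =
     {e \<in> induced_edges E A. \<forall>e' \<in> induced_edges E A. w e \<le> w e'}"

definition P_min :: "'a set set \<Rightarrow> ('a set \<Rightarrow> real) \<Rightarrow> 'a set \<Rightarrow> 'a set set" where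
  "P_min E w A = components A (induced_edges E A - min_edges E w A)"

definition P_min_tilde :: "'a set set \<Rightarrow> ('a set \<Rightarrow> real) \<Rightarrow> 'a set \<Rightarrow> 'a set set" where
  "P_min_tilde E w A = (\<Union>C \<in> components A (induced_edges E A). P_min E w C)"


section \<open>Games\<close>

text \<open>A game on \<open>N\<close> is a total function on sets of players; only subsets of \<open>N\<close> are relevant.\<close>

definition is_game :: "('a set \<Rightarrow> real) \<Rightarrow> bool" where
  "is_game v \<longleftrightarrow> v {} = 0"

definition convex_game :: "'a set \<Rightarrow> ('a set \<Rightarrow> real) \<Rightarrow> bool" where
  "convex_game N v \<longleftrightarrow>
     is_game v \<and> (\<forall>A B. A \<subseteq> N \<longrightarrow> B \<subseteq> N \<longrightarrow> v (A \<union> B) + v (A \<inter> B) \<ge> v A + v B)"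

definition restricted_game ::
    "'a set set \<Rightarrow> ('a set \<Rightarrow> real) \<Rightarrow> ('a set \<Rightarrow> real) \<Rightarrow> 'a set \<Rightarrow> real" where
  "restricted_game E w v A = (\<Sum>F \<in> P_min_tilde E w A. v F)"


section \<open>The conditions on the weights\<close>

text \<open>As the three edges are distinct, \<open>{f1, f2, f3} = {e1, e2, e3}\<close> says that
  \<open>f1, f2, f3\<close> is a renumbering of \<open>e1, e2, e3\<close>.\<close>

definition star_condition :: "'a set \<Rightarrow> 'a set set \<Rightarrow> ('a set \<Rightarrow> real) \<Rightarrow> bool" where
  "star_condition N E w \<longleftrightarrow>
     (\<forall>x \<in> N. \<forall>e1 \<in> E. \<forall>e2 \<in> E. \<forall>e3 \<in> E.
        x \<in> e1 \<and> x \<in> e2 \<and> x \<in> e3 \<and> e1 \<noteq> e2 \<and> e1 \<noteq> e3 \<and> e2 \<noteq> e3 \<longrightarrow>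
        (\<exists>f1 f2 f3. {f1, f2, f3} = {e1, e2, e3} \<and> w f1 \<le> w f2 \<and> w f2 = w f3))"

definition path_condition :: "'a set \<Rightarrow> 'a set set \<Rightarrow> ('a set \<Rightarrow> real) \<Rightarrow> bool" where
  "path_condition N E w \<longleftrightarrow>
     (\<forall>p i j k. is_path N E p \<and> i < j \<and> j < k \<and> Suc k < length p \<longrightarrow>
        w (path_edge p j) \<le> max (w (path_edge p i)) (w (path_edge p k)))"

end

theory Submission
  imports Defs
begin

text \<open>
  The blocks of the partition of \<open>A\<close> are the components of \<open>A\<close> under its alive edges, those with a
  strictly lighter edge in the same component of the subgraph induced by \<open>A\<close>. Up to a modular term,
  the restricted game is therefore the link game, which sums \<open>v\<close> over the components of an edge set,
  evaluated at the alive edges of \<open>A\<close>. On a forest the link game of a convex game is monotone and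
  supermodular, so the restricted game is convex as soon as the monotone map from \<open>A\<close> to its alive
  edges preserves intersections. This holds under the Star and Path conditions: the path from an
  edge to the first lighter edge is then unique in the whole forest, so if it exists
  inside \<open>A\<close> and inside \<open>B\<close>, it lies in \<open>A \<inter> B\<close>.
  Conversely, a violation of either condition yields \<open>A\<close> and \<open>B\<close> such that \<open>A \<inter> B\<close> is an edge alive
  in both, and the unanimity game of that edge then violates convexity.
\<close>


section \<open>Connectedness\<close>

abbreviation adj :: "'a set \<Rightarrow> 'a set set \<Rightarrow> ('a \<times> 'a) set" where
  "adj A F \<equiv> {(u, u'). u \<in> A \<and> u' \<in> A \<and> {u, u'} \<in> F}"

lemma connected_rel_iff:
  "(x, y) \<in> connected_rel A F \<longleftrightarrow> x \<in> A \<and> (x, y) \<in> (adj A F)\<^sup>*"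
proof -
  have "y \<in> A" if "(x, y) \<in> (adj A F)\<^sup>*" "x \<in> A"
    using that by (induction rule: rtrancl_induct) auto
  then show ?thesis by (auto simp: connected_rel_def)
qed

lemma connected_rel_refl: "x \<in> A \<Longrightarrow> (x, x) \<in> connected_rel A F"
  by (simp add: connected_rel_iff)

lemma connected_rel_edge:
  "x \<in> A \<Longrightarrow> y \<in> A \<Longrightarrow> {x, y} \<in> F \<Longrightarrow> (x, y) \<in> connected_rel A F"
  by (auto simp: connected_rel_iff)

lemma connected_rel_sym: "(x, y) \<in> connected_rel A F \<Longrightarrow> (y, x) \<in> connected_rel A F"
proof -
  assume *: "(x, y) \<in> connected_rel A F"
  have "sym (adj A F)" by (auto simp: sym_def insert_commute)
  then have "sym ((adj A F)\<^sup>*)" by (rule sym_rtrancl)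
  with * show ?thesis by (auto simp: connected_rel_def sym_def)
qed

lemma connected_rel_trans:
  "(x, y) \<in> connected_rel A F \<Longrightarrow> (y, z) \<in> connected_rel A F \<Longrightarrow> (x, z) \<in> connected_rel A F"
  unfolding connected_rel_iff by (meson rtrancl_trans)

lemma connected_rel_in: "(x, y) \<in> connected_rel A F \<Longrightarrow> x \<in> A \<and> y \<in> A"
  by (auto simp: connected_rel_def)

lemma equiv_connected_rel: "equiv A (connected_rel A F)"
  by (rule equivI)
    (auto simp: refl_on_def sym_def trans_def
      intro: connected_rel_refl connected_rel_sym dest: connected_rel_in connected_rel_trans)

lemma connected_rel_mono:
  assumes "A \<subseteq> B" "F \<subseteq> G" shows "connected_rel A F \<subseteq> connected_rel B G"
proof -
  have "(adj A F)\<^sup>* \<subseteq> (adj B G)\<^sup>*" using assms by (intro rtrancl_mono) auto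
  then show ?thesis using assms(1) by (auto simp: connected_rel_iff)
qed

lemma components_eq_image: "components A F = (\<lambda>x. connected_rel A F `` {x}) ` A"
  by (auto simp: components_def quotient_def)

lemma class_eq:
  "(x, y) \<in> connected_rel A F \<Longrightarrow> connected_rel A F `` {x} = connected_rel A F `` {y}"
  by (rule equiv_class_eq[OF equiv_connected_rel])

text \<open>A walk is shortened while it is followed: a new vertex is appended, and at a vertex
  already visited the path is cut back to it.\<close>

lemma path_of_connected:
  assumes "(x, y) \<in> connected_rel A F"
  shows "\<exists>p. successively (\<lambda>u v. {u, v} \<in> F) p \<and> distinct p \<and> set p \<subseteq> A \<and> p \<noteq> [] \<and>
    hd p = x \<and> last p = y"
proof -
  have "x \<in> A" "(x, y) \<in> (adj A F)\<^sup>*" using assms by (auto simp: connected_rel_iff)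
  from this(2) show ?thesis
  proof (induction rule: rtrancl_induct)
    case base
    show ?case using \<open>x \<in> A\<close> by (intro exI[of _ "[x]"]) auto
  next
    case (step y z)
    then obtain p where p: "successively (\<lambda>u v. {u, v} \<in> F) p" "distinct p" "set p \<subseteq> A" "p \<noteq> []"
      "hd p = x" "last p = y" by blast
    show ?case
    proof (cases "z \<in> set p")
      case True
      then obtain q r where "p = (q @ [z]) @ r" by (metis append.assoc append_Cons append_Nil split_list)
      then show ?thesis using p
        by (intro exI[of _ "q @ [z]"]) (auto simp: successively_append_iff hd_append split: if_splits)
    next
      case False
      then show ?thesis using p step.hyps
        by (intro exI[of _ "p @ [z]"]) (auto simp: successively_append_iff)
    qed
  qed
qed

section \<open>Paths in a forest\<close>

lemma is_path_iff_successively: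
  "is_path N E p \<longleftrightarrow> p \<noteq> [] \<and> distinct p \<and> set p \<subseteq> N \<and> successively (\<lambda>u v. {u, v} \<in> E) p"
  by (auto simp: is_path_def path_edge_def successively_conv_nth)

text \<open>A path from \<open>a\<close> to \<open>b\<close> inside \<open>F\<close>, closed by
  \<open>{a, b}\<close>, would be a cycle. It has at least three vertices, because a path of two
  vertices would put \<open>{a, b}\<close> into \<open>F\<close>.\<close>

lemma cycle_free_not_connected:
  assumes "finite_simple_graph N E" "cycle_free N E" "F \<subseteq> E" "{a, b} \<in> E" "{a, b} \<notin> F"
  shows "(a, b) \<notin> connected_rel N F"
proof
  assume "(a, b) \<in> connected_rel N F"
  then obtain p where p: "successively (\<lambda>u v. {u, v} \<in> F) p" "distinct p" "set p \<subseteq> N" "p \<noteq> []"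
    "hd p = a" "last p = b" using path_of_connected by metis
  have ab: "a \<noteq> b" using assms(1,4) by (auto simp: finite_simple_graph_def)
  have "3 \<le> length p"
  proof (rule ccontr)
    assume "\<not> 3 \<le> length p"
    then consider "length p = 0" | "length p = 1" | "length p = 2" by linarith
    then show False
    proof cases
      case 3
      then obtain u v where "p = [u, v]" by (auto simp: numeral_2_eq_2 length_Suc_conv)
      then show False using p assms(5) by auto
    qed (use p ab in \<open>auto simp: length_Suc_conv\<close>)
  qed
  moreover have "successively (\<lambda>u v. {u, v} \<in> E) p"
    using p(1) by (rule successively_mono) (use assms(3) in auto)
  ultimately have "is_cycle N E p"
    using p assms(4) by (auto simp: is_cycle_def is_path_iff_successively insert_commute)
  then show False using assms(2) by (auto simp: cycle_free_def)
qed

text \<open>Let \<open>z\<close> be the first vertex of \<open>p\<close> that lies on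
  \<open>q\<close>. Following \<open>p\<close> from \<open>x\<close> to \<open>z\<close> and then
  \<open>q\<close> backwards to \<open>x\<close> closes a cycle.\<close>

lemma cycle_free_paths_disjoint:
  assumes cf: "cycle_free N E"
    and p: "is_path N E (x # p)" and q: "is_path N E (x # q)"
    and hd: "p = [] \<or> q = [] \<or> hd p \<noteq> hd q"
  shows "set p \<inter> set q = {}"
proof (rule ccontr)
  assume "set p \<inter> set q \<noteq> {}"
  then have "\<exists>z\<in>set p. z \<in> set q" by auto
  then obtain p1 z p2 where p1: "p = p1 @ z # p2" "z \<in> set q" "\<forall>y\<in>set p1. y \<notin> set q"
    using split_list_first_prop[of p "\<lambda>z. z \<in> set q"] by blast
  then obtain q1 q2 where q1: "q = q1 @ z # q2" by (meson split_list)
  define c where "c = x # p1 @ z # rev q1"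
  \<comment> \<open>If both were empty, \<open>z\<close> would be the head of both \<open>p\<close>
    and \<open>q\<close>.\<close>
  have "p1 \<noteq> [] \<or> q1 \<noteq> []" using hd p1 q1 by auto
  then have "3 \<le> length c" by (cases p1; cases q1) (auto simp: c_def)
  moreover have "is_path N E c"
  proof -
    have "successively (\<lambda>u v. {u, v} \<in> E) (x # p1 @ [z])"
      using p p1(1)
      by (auto simp: is_path_iff_successively successively_append_iff successively_Cons hd_append
          split: if_splits)
    moreover have "successively (\<lambda>u v. {u, v} \<in> E) (z # rev q1)"
    proof -
      have "successively (\<lambda>u v. {u, v} \<in> E) (q1 @ [z])"
        using q q1 by (auto simp: is_path_iff_successively successively_append_iff successively_Cons)
      then have "successively (\<lambda>u v. {u, v} \<in> E) (rev (q1 @ [z]))"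
        by (subst successively_rev) (simp add: insert_commute)
      then show ?thesis by simp
    qed
    ultimately have "successively (\<lambda>u v. {u, v} \<in> E) c"
      by (auto simp: c_def successively_append_iff successively_Cons hd_append split: if_splits)
    then show ?thesis using p q p1 q1 by (auto simp: is_path_iff_successively c_def)
  qed
  moreover have "{last c, x} \<in> E"
    using q q1 by (cases q1)
      (auto simp: c_def is_path_iff_successively successively_Cons insert_commute)
  ultimately have "is_cycle N E c" by (simp add: is_cycle_def c_def)
  then show False using cf by (auto simp: cycle_free_def)
qed

text \<open>Two branches at \<open>x\<close> become one path through \<open>x\<close>, to which the
  Path condition can then be applied.\<close>

lemma cycle_free_join_paths:
  assumes "cycle_free N E" "is_path N E (x # p)" "is_path N E (x # q)"
    "p = [] \<or> q = [] \<or> hd p \<noteq> hd q"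
  shows "is_path N E (rev p @ x # q)"
proof -
  have "set p \<inter> set q = {}" using cycle_free_paths_disjoint[OF assms] .
  moreover have "successively (\<lambda>u v. {u, v} \<in> E) (rev (x # p))"
    using assms(2) by (subst successively_rev) (simp add: is_path_iff_successively insert_commute)
  ultimately show ?thesis using assms(2,3)
    by (auto simp: is_path_iff_successively successively_append_iff successively_Cons)
qed


section \<open>The restricted game as a graph game\<close>

text \<open>Not being minimal in one's component is expressed by a lighter witness \<open>f\<close>,
  so that monotonicity in \<open>A\<close> is immediate. Which ends \<open>x\<close> and
  \<open>y\<close> are connected is immaterial, since the two ends of an edge always are.\<close>

definition alive :: "'a set set \<Rightarrow> ('a set \<Rightarrow> real) \<Rightarrow> 'a set \<Rightarrow> 'a set set" where
  "alive E w A = {e \<in> induced_edges E A. \<exists>f \<in> induced_edges E A. w f < w e \<and>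
     (\<exists>x\<in>e. \<exists>y\<in>f. (x, y) \<in> connected_rel A (induced_edges E A))}"

lemma edge_connected:
  assumes "finite_simple_graph N E" "e \<in> induced_edges E A" "x \<in> e" "y \<in> e"
  shows "(x, y) \<in> connected_rel A (induced_edges E A)"
proof (cases "x = y")
  case True
  then show ?thesis using assms by (auto simp: induced_edges_def intro: connected_rel_refl)
next
  case False
  have "card e = 2" using assms by (auto simp: finite_simple_graph_def induced_edges_def)
  then have "e = {x, y}" using False assms(3,4) by (auto simp: card_2_iff)
  then show ?thesis using assms(2) by (auto simp: induced_edges_def intro: connected_rel_edge)
qed

text \<open>In the component \<open>C\<close> of \<open>y\<close>, deleting the minimum weight edges
  leaves exactly the alive edges of \<open>A\<close> that lie in \<open>C\<close>, and a walk along
  alive edges from \<open>y\<close> cannot leave \<open>C\<close>.\<close>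

lemma alive_class:
  assumes g: "finite_simple_graph N E" and y: "y \<in> A"
    and C: "C = connected_rel A (induced_edges E A) `` {y}"
  shows "connected_rel C (induced_edges E C - min_edges E w C) `` {y} =
    connected_rel A (alive E w A) `` {y}"
proof -
  let ?R = "connected_rel A (induced_edges E A)"
  have CA: "C \<subseteq> A" and yC: "y \<in> C" using C y by (auto dest: connected_rel_in intro: connected_rel_refl)
  have alive_step: "v \<in> C \<and> {u, v} \<in> induced_edges E C - min_edges E w C"
    if u: "u \<in> C" and e: "{u, v} \<in> alive E w A" for u v
  proof -
    obtain f s t where f: "{u, v} \<in> induced_edges E A" "f \<in> induced_edges E A" "w f < w {u, v}"
      "s \<in> {u, v}" "t \<in> f" "(s, t) \<in> ?R"
      using e by (auto simp: alive_def)
    have yu: "(y, u) \<in> ?R" using u C by auto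
    have yv: "(y, v) \<in> ?R" using edge_connected[OF g f(1), of u v] connected_rel_trans[OF yu] by simp
    have "(y, s) \<in> ?R" using yu yv f(4) by auto
    then have yt: "(y, t) \<in> ?R" using f(6) by (rule connected_rel_trans)
    \<comment> \<open>The lighter edge lies in \<open>C\<close> too, so it shows that
      \<open>{u, v}\<close> is not minimal there.\<close>
    have "f \<subseteq> C"
      using edge_connected[OF g f(2) f(5)] connected_rel_trans[OF yt] C by auto
    then have "f \<in> induced_edges E C" using f(2) by (auto simp: induced_edges_def)
    moreover have "{u, v} \<in> induced_edges E C" "v \<in> C"
      using f(1) yu yv C by (auto simp: induced_edges_def)
    ultimately show ?thesis using f(3) by (auto simp: min_edges_def not_le)
  qed
  have not_min_alive: "{u, v} \<in> alive E w A" if e: "{u, v} \<in> induced_edges E C - min_edges E w C" for u v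
  proof -
    obtain f where f: "f \<in> induced_edges E C" "w f < w {u, v}"
      using e by (auto simp: min_edges_def not_le)
    have "card f = 2" using g f by (auto simp: finite_simple_graph_def induced_edges_def)
    then obtain t where t: "t \<in> f" by fastforce
    have "u \<in> C" "t \<in> C" using e f t by (auto simp: induced_edges_def)
    then have "(u, t) \<in> ?R" using C by (auto dest: connected_rel_sym connected_rel_trans)
    moreover have "{u, v} \<in> induced_edges E A" "f \<in> induced_edges E A"
      using e f CA by (auto simp: induced_edges_def)
    ultimately show ?thesis using f(2) t by (auto simp: alive_def)
  qed
  have "connected_rel C (induced_edges E C - min_edges E w C) \<subseteq> connected_rel A (alive E w A)"
  proof -
    have "adj C (induced_edges E C - min_edges E w C) \<subseteq> adj A (alive E w A)"
      using not_min_alive CA by blast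
    from rtrancl_mono[OF this] show ?thesis using CA by (auto simp: connected_rel_iff)
  qed
  moreover have "(y, z) \<in> connected_rel C (induced_edges E C - min_edges E w C)"
    if "(y, z) \<in> connected_rel A (alive E w A)" for z
  proof -
    have "(y, z) \<in> (adj A (alive E w A))\<^sup>*" using that by (simp add: connected_rel_iff)
    then show ?thesis
    proof (induction rule: rtrancl_induct)
      case base
      show ?case using yC by (rule connected_rel_refl)
    next
      case (step u v)
      have "u \<in> C" using step.IH connected_rel_in by metis
      with \<open>(u, v) \<in> adj A (alive E w A)\<close>
      have "v \<in> C \<and> {u, v} \<in> induced_edges E C - min_edges E w C"
        using alive_step by blast
      then have "(u, v) \<in> connected_rel C (induced_edges E C - min_edges E w C)"
        using \<open>u \<in> C\<close> connected_rel_edge by metis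
      then show ?case using step.IH connected_rel_trans by metis
    qed
  qed
  ultimately show ?thesis by auto
qed

text \<open>By \<open>alive_class\<close> every block is the alive class of one of its vertices, and
  the components of the induced subgraph cover \<open>A\<close>.\<close>

lemma P_min_tilde_eq_components:
  assumes "finite_simple_graph N E"
  shows "P_min_tilde E w A = components A (alive E w A)"
proof -
  let ?C = "\<lambda>x. connected_rel A (induced_edges E A) `` {x}"
  have *: "P_min E w (?C x) = (\<lambda>y. connected_rel A (alive E w A) `` {y}) ` ?C x" if "x \<in> A" for x
    unfolding P_min_def components_eq_image
  proof (rule image_cong[OF refl])
    fix y assume y: "y \<in> ?C x"
    then have "?C x = ?C y" by (intro class_eq) auto
    moreover have "y \<in> A" using y connected_rel_in by (metis Image_singleton_iff)
    ultimately show "connected_rel (?C x) (induced_edges E (?C x) - min_edges E w (?C x)) `` {y} =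
      connected_rel A (alive E w A) `` {y}"
      using alive_class[OF assms] by metis
  qed
  have "P_min_tilde E w A = (\<Union>x\<in>A. P_min E w (?C x))"
    by (simp add: P_min_tilde_def components_eq_image)
  also have "\<dots> = (\<Union>x\<in>A. (\<lambda>y. connected_rel A (alive E w A) `` {y}) ` ?C x)"
    using * by auto
  also have "\<dots> = (\<lambda>y. connected_rel A (alive E w A) `` {y}) ` (\<Union>x\<in>A. ?C x)" by blast
  also have "(\<Union>x\<in>A. ?C x) = A"
    by (auto dest: connected_rel_in intro: connected_rel_refl)
  finally show ?thesis by (simp add: components_eq_image)
qed

lemma alive_mono:
  assumes "A \<subseteq> B" shows "alive E w A \<subseteq> alive E w B"
proof -
  have "induced_edges E A \<subseteq> induced_edges E B" using assms by (auto simp: induced_edges_def)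
  moreover from connected_rel_mono[OF assms this]
  have "connected_rel A (induced_edges E A) \<subseteq> connected_rel B (induced_edges E B)" .
  ultimately show ?thesis unfolding alive_def by blast
qed

lemma alive_subset: "alive E w A \<subseteq> E"
  by (auto simp: alive_def induced_edges_def)

lemma alive_edge_subset: "e \<in> alive E w A \<Longrightarrow> e \<subseteq> A"
  by (simp add: alive_def induced_edges_def)

lemma finite_components: "finite A \<Longrightarrow> finite (components A F)"
  by (simp add: components_eq_image)


section \<open>Supermodularity of the link game\<close>

text \<open>The players are now the edges. Components are always taken on all of \<open>N\<close>,
  so different player sets are compared through their edge sets alone.\<close>

definition link_game :: "'a set \<Rightarrow> ('a set \<Rightarrow> real) \<Rightarrow> 'a set set \<Rightarrow> real" where
  "link_game N v F = (\<Sum>C\<in>components N F. v C)"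

text \<open>No edge of \<open>F\<close> touches a vertex outside \<open>A\<close>, so such a vertex
  is isolated.\<close>

lemma components_superset:
  assumes "A \<subseteq> N" "\<And>e. e \<in> F \<Longrightarrow> e \<subseteq> A"
  shows "components N F = components A F \<union> (\<lambda>x. {x}) ` (N - A)"
proof -
  have adj: "adj N F = adj A F" using assms by auto
  have 1: "connected_rel N F `` {x} = connected_rel A F `` {x}" if "x \<in> A" for x
    using that assms(1) unfolding Image_def connected_rel_iff adj by auto
  have 2: "connected_rel N F `` {x} = {x}" if "x \<in> N - A" for x
  proof -
    have "y = x" if "(x, y) \<in> (adj A F)\<^sup>*" for y
      using that \<open>x \<in> N - A\<close> by (auto elim: converse_rtranclE)
    then show ?thesis using that unfolding Image_def connected_rel_iff adj by auto
  qed
  have "components N F = (\<lambda>x. connected_rel N F `` {x}) ` A \<union> (\<lambda>x. connected_rel N F `` {x}) ` (N - A)"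
    unfolding components_eq_image using assms(1) by (metis Diff_partition image_Un)
  moreover have "(\<lambda>x. connected_rel N F `` {x}) ` (N - A) = (\<lambda>x. {x}) ` (N - A)"
    by (rule image_cong[OF refl 2])
  ultimately show ?thesis using 1 by (simp add: components_eq_image cong: image_cong)
qed

text \<open>Passing from \<open>A\<close> to \<open>N\<close> adds to the alive graph only the
  singletons of \<open>N - A\<close>; their total value is modular in \<open>A\<close>.\<close>

lemma restricted_game_eq_link_game:
  assumes g: "finite_simple_graph N E" and A: "A \<subseteq> N"
  shows "restricted_game E w v A = link_game N v (alive E w A) - (\<Sum>x\<in>N - A. v {x})"
proof -
  have fin: "finite N" using g by (simp add: finite_simple_graph_def)
  have "link_game N v (alive E w A) =
    (\<Sum>C\<in>components A (alive E w A). v C) + (\<Sum>C\<in>(\<lambda>x. {x}) ` (N - A). v C)"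
    unfolding link_game_def
  proof (subst components_superset[OF A])
    show "sum v (components A (alive E w A) \<union> (\<lambda>x. {x}) ` (N - A)) =
      sum v (components A (alive E w A)) + sum v ((\<lambda>x. {x}) ` (N - A))"
    proof (rule sum.union_disjoint)
      show "finite (components A (alive E w A))"
        using fin A by (auto intro: finite_components finite_subset)
      show "components A (alive E w A) \<inter> (\<lambda>x. {x}) ` (N - A) = {}"
        by (auto simp: components_eq_image dest!: connected_rel_in)
    qed (use fin in auto)
  qed (rule alive_edge_subset)
  then show ?thesis
    by (simp add: restricted_game_def P_min_tilde_eq_components[OF g] sum.reindex)
qed

lemma components_insert_edge:
  assumes ab: "a \<in> N" "b \<in> N" and nc: "(a, b) \<notin> connected_rel N F"
  defines "Ca \<equiv> connected_rel N F `` {a}" and "Cb \<equiv> connected_rel N F `` {b}"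
  shows "components N (insert {a, b} F) = insert (Ca \<union> Cb) (components N F - {Ca, Cb})"
proof -
  let ?R = "connected_rel N F" and ?R' = "connected_rel N (insert {a, b} F)"
  have sub: "?R \<subseteq> ?R'" by (rule connected_rel_mono) auto
  have abR: "(a, b) \<in> ?R'" using ab by (intro connected_rel_edge) auto
  \<comment> \<open>Both ends of the new edge lie in \<open>Ca \<union> Cb\<close>, so a connection
    that needs this edge starts and ends in that set.\<close>
  have up: "(x, y) \<in> ?R \<or> (x \<in> Ca \<union> Cb \<and> y \<in> Ca \<union> Cb)" if "(x, y) \<in> ?R'" for x y
  proof -
    have "x \<in> N" "(x, y) \<in> (adj N (insert {a, b} F))\<^sup>*" using that by (auto simp: connected_rel_iff)
    from this(2) show ?thesis
    proof (induction rule: rtrancl_induct)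
      case base
      show ?case using \<open>x \<in> N\<close> by (auto intro: connected_rel_refl)
    next
      case (step y z)
      show ?case
      proof (cases "{y, z} \<in> F")
        case True
        then have "(y, z) \<in> ?R" using step.hyps by (auto intro: connected_rel_edge)
        then show ?thesis using step.IH unfolding Ca_def Cb_def
          by (auto intro: connected_rel_trans)
      next
        case False
        then have "{y, z} = {a, b}" using step.hyps by auto
        then have yz: "y \<in> Ca \<union> Cb" "z \<in> Ca \<union> Cb" using ab
          by (auto simp: Ca_def Cb_def doubleton_eq_iff intro: connected_rel_refl)
        have "x \<in> Ca \<union> Cb" using step.IH yz(1)
          by (auto simp: Ca_def Cb_def dest: connected_rel_sym connected_rel_trans)
        with yz show ?thesis by blast
      qed
    qed
  qed
  have ca: "?R' `` {x} = Ca \<union> Cb" if x: "x \<in> Ca \<union> Cb" for x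
  proof -
    have ax: "(a, x) \<in> ?R'" using x sub abR
      by (auto simp: Ca_def Cb_def dest: connected_rel_trans)
    have ay: "(a, y) \<in> ?R'" if "y \<in> Ca \<union> Cb" for y using that sub abR
      by (auto simp: Ca_def Cb_def dest: connected_rel_trans)
    have "(x, y) \<in> ?R'" if "y \<in> Ca \<union> Cb" for y
      using connected_rel_trans[OF connected_rel_sym[OF ax] ay[OF that]] .
    moreover have "y \<in> Ca \<union> Cb" if "(x, y) \<in> ?R'" for y
      using up[OF that] x by (auto simp: Ca_def Cb_def dest: connected_rel_trans)
    ultimately show ?thesis by auto
  qed
  have other: "?R' `` {x} = ?R `` {x}" if "x \<notin> Ca \<union> Cb" for x
    using up sub that by auto
  have ne: "?R `` {x} \<noteq> Ca \<and> ?R `` {x} \<noteq> Cb" if "x \<in> N" "x \<notin> Ca \<union> Cb" for x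
    using that connected_rel_refl[of x N F] by auto
  have eq: "?R `` {x} = Ca \<or> ?R `` {x} = Cb" if "x \<in> Ca \<union> Cb" for x
    using that class_eq[of a x N F] class_eq[of b x N F] by (auto simp: Ca_def Cb_def)
  have N: "N = (Ca \<union> Cb) \<union> (N - (Ca \<union> Cb))"
    by (auto simp: Ca_def Cb_def dest: connected_rel_in)
  have "a \<in> Ca" using ab by (auto simp: Ca_def intro: connected_rel_refl)
  then have "components N (insert {a, b} F) = insert (Ca \<union> Cb) ((\<lambda>x. ?R `` {x}) ` (N - (Ca \<union> Cb)))"
  proof -
    have "(\<lambda>x. ?R' `` {x}) ` N =
        (\<lambda>x. ?R' `` {x}) ` (Ca \<union> Cb) \<union> (\<lambda>x. ?R' `` {x}) ` (N - (Ca \<union> Cb))"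
      using N by (metis image_Un)
    also have "(\<lambda>x. ?R' `` {x}) ` (Ca \<union> Cb) = {Ca \<union> Cb}"
      using ca \<open>a \<in> Ca\<close> by auto
    also have "(\<lambda>x. ?R' `` {x}) ` (N - (Ca \<union> Cb)) = (\<lambda>x. ?R `` {x}) ` (N - (Ca \<union> Cb))"
      by (rule image_cong[OF refl other]) auto
    finally show ?thesis by (simp add: components_eq_image)
  qed
  also have "(\<lambda>x. ?R `` {x}) ` (N - (Ca \<union> Cb)) = components N F - {Ca, Cb}"
    unfolding components_eq_image using ne eq by blast
  finally show ?thesis .
qed

lemma link_game_insert_edge:
  assumes "finite N" "a \<in> N" "b \<in> N" and nc: "(a, b) \<notin> connected_rel N F"
  defines "Ca \<equiv> connected_rel N F `` {a}" and "Cb \<equiv> connected_rel N F `` {b}"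
  shows "link_game N v (insert {a, b} F) = link_game N v F + v (Ca \<union> Cb) - v Ca - v Cb"
    and "Ca \<inter> Cb = {}"
proof -
  have aCa: "a \<in> Ca" "b \<in> Cb" "b \<notin> Ca" using assms by (auto intro: connected_rel_refl)
  then have ne: "Ca \<noteq> Cb" by auto
  have mem: "Ca \<in> components N F" "Cb \<in> components N F"
    using assms by (auto simp: components_eq_image)
  have fin: "finite (components N F)" using assms(1) by (rule finite_components)
  \<comment> \<open>The merged block is new, so it contributes a term of its own to the sum.\<close>
  have "Ca \<union> Cb \<notin> components N F"
  proof
    assume "Ca \<union> Cb \<in> components N F"
    then obtain x where "Ca \<union> Cb = connected_rel N F `` {x}" by (auto simp: components_eq_image)
    then have "(x, a) \<in> connected_rel N F" "(x, b) \<in> connected_rel N F" using aCa by auto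
    then show False using nc by (meson connected_rel_sym connected_rel_trans)
  qed
  then have "link_game N v (insert {a, b} F) = v (Ca \<union> Cb) + sum v (components N F - {Ca, Cb})"
    unfolding link_game_def components_insert_edge[OF assms(2,3) nc, folded Ca_def Cb_def]
    using fin by (subst sum.insert) auto
  also have "sum v (components N F - {Ca, Cb}) = link_game N v F - v Ca - v Cb"
    using fin mem ne by (simp add: link_game_def sum_diff)
  finally show "link_game N v (insert {a, b} F) = link_game N v F + v (Ca \<union> Cb) - v Ca - v Cb"
    by simp
  show "Ca \<inter> Cb = {}"
    using nc unfolding Ca_def Cb_def by (auto dest: connected_rel_sym connected_rel_trans)
qed

text \<open>The two sets are enlarged one at a time: convexity is applied to \<open>C'\<close> and
  \<open>C \<union> D\<close>, then to \<open>D'\<close> and \<open>C' \<union> D\<close>. As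
  \<open>C'\<close> and \<open>D'\<close> are disjoint, the intersections are \<open>C\<close> and
  \<open>D\<close>.\<close>

lemma convex_game_merge_mono:
  assumes "convex_game N v" "C \<subseteq> C'" "D \<subseteq> D'" "C' \<inter> D' = {}" "C' \<subseteq> N" "D' \<subseteq> N"
  shows "v (C \<union> D) - v C - v D \<le> v (C' \<union> D') - v C' - v D'"
proof -
  have conv: "v A + v B \<le> v (A \<union> B) + v (A \<inter> B)" if "A \<subseteq> N" "B \<subseteq> N" for A B
    using assms(1) that by (auto simp: convex_game_def)
  have "v C' + v (C \<union> D) \<le> v (C' \<union> (C \<union> D)) + v (C' \<inter> (C \<union> D))"
    using assms by (intro conv) auto
  moreover have "C' \<union> (C \<union> D) = C' \<union> D" "C' \<inter> (C \<union> D) = C" using assms by auto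
  moreover have "v D' + v (C' \<union> D) \<le> v (D' \<union> (C' \<union> D)) + v (D' \<inter> (C' \<union> D))"
    using assms by (intro conv) auto
  moreover have "D' \<union> (C' \<union> D) = C' \<union> D'" "D' \<inter> (C' \<union> D) = D" using assms by auto
  ultimately show ?thesis by simp
qed

section \<open>The link game of a convex game on a forest\<close>

context
  fixes N :: "'a set" and E :: "'a set set" and v :: "'a set \<Rightarrow> real"
  assumes g: "finite_simple_graph N E" and cf: "cycle_free N E" and conv: "convex_game N v"
begin

lemma edge_obtain:
  assumes "e \<in> E" obtains a b where "e = {a, b}" "a \<in> N" "b \<in> N"
proof -
  have "card e = 2" "e \<subseteq> N" using g assms by (auto simp: finite_simple_graph_def)
  then show ?thesis using that by (auto simp: card_2_iff)
qed

text \<open>In a forest a new edge always merges two distinct components. More edges make both of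
  them larger, and by \<open>convex_game_merge_mono\<close> the gain from merging grows with
  them.\<close>

lemma link_game_marginal_mono:
  assumes "F \<subseteq> F'" "F' \<subseteq> E" "e \<in> E" "e \<notin> F'"
  shows "link_game N v (insert e F) - link_game N v F \<le> link_game N v (insert e F') - link_game N v F'"
    and "link_game N v F \<le> link_game N v (insert e F)"
proof -
  obtain a b where e: "e = {a, b}" and ab: "a \<in> N" "b \<in> N" using edge_obtain[OF assms(3)] .
  have fin: "finite N" using g by (simp add: finite_simple_graph_def)
  have nc': "(a, b) \<notin> connected_rel N F'"
    using assms e by (intro cycle_free_not_connected[OF g cf]) auto
  then have nc: "(a, b) \<notin> connected_rel N F"
    using connected_rel_mono[OF subset_refl assms(1), of N] by auto
  have sub: "connected_rel N F `` {x} \<subseteq> connected_rel N F' `` {x}" for x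
    using connected_rel_mono[OF subset_refl assms(1), of N] by auto
  have inN: "connected_rel N G `` {x} \<subseteq> N" for G x by (auto dest: connected_rel_in)
  note i = link_game_insert_edge[OF fin ab nc] and i' = link_game_insert_edge[OF fin ab nc']
  show "link_game N v (insert e F) - link_game N v F \<le> link_game N v (insert e F') - link_game N v F'"
    using convex_game_merge_mono[OF conv sub sub i'(2) inN inN] i(1)[of v] i'(1)[of v] e by simp
  \<comment> \<open>For the second claim the merged components are compared with two empty sets,
    whose merging gains nothing.\<close>
  have "v {} = 0" using conv by (simp add: convex_game_def is_game_def)
  then show "link_game N v F \<le> link_game N v (insert e F)"
    using convex_game_merge_mono[OF conv empty_subsetI empty_subsetI i(2) inN inN] i(1)[of v] e by simp
qed

lemma finite_edges: "finite E"
  using g by (auto simp: finite_simple_graph_def intro: finite_subset[of E "Pow N"])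

text \<open>The edges of \<open>H\<close> are added one by one and the marginal inequalities
  telescope.\<close>

lemma link_game_increment_mono:
  assumes "finite H" "F \<subseteq> F'" "F' \<subseteq> E" "H \<subseteq> E" "H \<inter> F' = {}"
  shows "link_game N v (F \<union> H) - link_game N v F \<le> link_game N v (F' \<union> H) - link_game N v F'"
  using assms
proof (induction H rule: finite_induct)
  case (insert e H)
  then have "link_game N v (insert e (F \<union> H)) - link_game N v (F \<union> H)
      \<le> link_game N v (insert e (F' \<union> H)) - link_game N v (F' \<union> H)"
    by (intro link_game_marginal_mono) auto
  with insert show ?case by simp
qed simp

lemma link_game_mono:
  assumes "F \<subseteq> F'" "F' \<subseteq> E"
  shows "link_game N v F \<le> link_game N v F'"
proof -
  have "link_game N v F \<le> link_game N v (F \<union> H)" if "finite H" "H \<subseteq> F' - F" for H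
    using that
  proof (induction H rule: finite_induct)
    case (insert e H)
    have "link_game N v (F \<union> H) \<le> link_game N v (insert e (F \<union> H))"
      using insert assms by (intro link_game_marginal_mono(2)[of _ "F \<union> H"]) auto
    with insert show ?case by simp
  qed simp
  from this[of "F' - F"] show ?thesis
    using assms finite_edges by (simp add: Un_absorb1 finite_subset)
qed

lemma link_game_supermodular:
  assumes "X \<subseteq> E" "Y \<subseteq> E"
  shows "link_game N v X + link_game N v Y \<le> link_game N v (X \<union> Y) + link_game N v (X \<inter> Y)"
proof -
  \<comment> \<open>Supermodularity compares the gain from \<open>X - Y\<close> on top of
    \<open>X \<inter> Y\<close> with the gain on top of \<open>Y\<close>.\<close>
  have "link_game N v ((X \<inter> Y) \<union> (X - Y)) - link_game N v (X \<inter> Y)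
      \<le> link_game N v (Y \<union> (X - Y)) - link_game N v Y"
    using assms finite_edges by (intro link_game_increment_mono) (auto intro: finite_subset)
  moreover have "(X \<inter> Y) \<union> (X - Y) = X" "Y \<union> (X - Y) = X \<union> Y" by auto
  ultimately show ?thesis by simp
qed

text \<open>Supermodularity is applied to the alive sets of \<open>A\<close> and \<open>B\<close>.
  Their intersection is the alive set of \<open>A \<inter> B\<close>; their union may be smaller
  than that of \<open>A \<union> B\<close>, a gap closed by monotonicity of the link game.\<close>

lemma restricted_game_convex:
  assumes inter: "\<And>A B. A \<subseteq> N \<Longrightarrow> B \<subseteq> N \<Longrightarrow> alive E w A \<inter> alive E w B \<subseteq> alive E w (A \<inter> B)"
  shows "convex_game N (restricted_game E w v)"
  unfolding convex_game_def
proof (intro conjI allI impI)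
  show "is_game (restricted_game E w v)"
    by (simp add: is_game_def restricted_game_def P_min_tilde_def components_def)
next
  fix A B assume A: "A \<subseteq> N" and B: "B \<subseteq> N"
  let ?L = "link_game N v" and ?a = "alive E w" and ?s = "\<lambda>A. \<Sum>x\<in>N - A. v {x}"
  have fin: "finite N" using g by (simp add: finite_simple_graph_def)
  have "?a A \<inter> ?a B = ?a (A \<inter> B)"
    using inter[OF A B] alive_mono[of "A \<inter> B" A E w] alive_mono[of "A \<inter> B" B E w] by auto
  moreover have "?L (?a A) + ?L (?a B) \<le> ?L (?a A \<union> ?a B) + ?L (?a A \<inter> ?a B)"
    by (rule link_game_supermodular[OF alive_subset alive_subset])
  moreover have "?L (?a A \<union> ?a B) \<le> ?L (?a (A \<union> B))"
    using alive_mono[of A "A \<union> B" E w] alive_mono[of B "A \<union> B" E w]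
    by (intro link_game_mono[OF _ alive_subset]) auto
  \<comment> \<open>The singleton terms are modular and cancel.\<close>
  moreover have "?s A + ?s B = ?s (A \<union> B) + ?s (A \<inter> B)"
    using sum.union_inter[of "N - A" "N - B" "\<lambda>x. v {x}"] fin
    by (simp add: Diff_Int Diff_Un)
  ultimately show "restricted_game E w v (A \<union> B) + restricted_game E w v (A \<inter> B)
      \<ge> restricted_game E w v A + restricted_game E w v B"
    using A B by (simp add: restricted_game_eq_link_game[OF g] le_infI1)
qed

end

section \<open>Sufficiency of the conditions\<close>

text \<open>A descent is a walk that stops right after its first edge of weight below \<open>c\<close>. An edge of
  weight \<open>c\<close> is alive in \<open>A\<close> iff some descent inside \<open>A\<close> starts with it; under the two conditions,
  a forest contains at most one such descent.\<close>

fun descent :: "'a set set \<Rightarrow> ('a set \<Rightarrow> real) \<Rightarrow> real \<Rightarrow> 'a list \<Rightarrow> bool" where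
  "descent E w c (x # y # p) \<longleftrightarrow> {x, y} \<in> E \<and> (if w {x, y} < c then p = [] else descent E w c (y # p))"
| "descent E w c p \<longleftrightarrow> False"

lemma descent_last:
  "descent E w c p \<Longrightarrow> \<exists>q u v. p = q @ [u, v] \<and> w {u, v} < c"
proof (induction p rule: descent.induct[of _ E w c])
  case (1 E w c x y p)
  show ?case
  proof (cases "w {x, y} < c")
    case True
    then show ?thesis using 1 by auto
  next
    case False
    then obtain q u v where "y # p = q @ [u, v]" "w {u, v} < c" using 1 by auto
    then show ?thesis by (intro exI[of _ "x # q"]) auto
  qed
qed auto

text \<open>The path is cut right after its first edge of weight below \<open>c\<close>; the edge
  \<open>{u, v}\<close> guarantees that there is one.\<close>

lemma descent_prefix:
  assumes "successively (\<lambda>u v. {u, v} \<in> E) p" "p = xs @ u # v # ys" "w {u, v} < c"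
  shows "\<exists>q s. p = q @ s \<and> descent E w c q"
  using assms
proof (induction xs arbitrary: p)
  case Nil
  then show ?case by (intro exI[of _ "[u, v]"] exI[of _ ys]) auto
next
  case (Cons x xs)
  obtain y p' where p: "p = x # y # p'" "y # p' = xs @ u # v # ys"
    using Cons.prems(2) by (cases xs) auto
  have "successively (\<lambda>u v. {u, v} \<in> E) (y # p')" using Cons.prems(1) p(1) by simp
  then have "\<exists>q s. y # p' = q @ s \<and> descent E w c q"
    using p(2) Cons.prems(3) by (rule Cons.IH)
  then obtain q s where q: "y # p' = q @ s" "descent E w c q" by blast
  then obtain q' where q': "q = y # q'" by (cases q) auto
  show ?case
  proof (cases "w {x, y} < c")
    case True
    then show ?thesis using p(1) Cons.prems(1) by (intro exI[of _ "[x, y]"] exI[of _ p']) auto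
  next
    case False
    then show ?thesis using p(1) q q' Cons.prems(1)
      by (intro exI[of _ "x # q"] exI[of _ s]) auto
  qed
qed

lemma descent_reaches_light_edge:
  assumes "descent E w c p" "set p \<subseteq> A"
  shows "\<exists>f \<in> induced_edges E A. w f < c \<and> (\<exists>y\<in>f. (hd p, y) \<in> connected_rel A (induced_edges E A))"
  using assms
proof (induction p rule: descent.induct[of _ E w c])
  case (1 E w c x y p)
  have xy: "{x, y} \<in> induced_edges E A" using 1 by (auto simp: induced_edges_def)
  show ?case
  proof (cases "w {x, y} < c")
    case True
    then show ?thesis using xy 1 by (intro bexI[OF _ xy]) (auto intro: connected_rel_refl)
  next
    case False
    then obtain f z where f: "f \<in> induced_edges E A" "w f < c" "z \<in> f"
      "(y, z) \<in> connected_rel A (induced_edges E A)" using 1 by auto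
    have "(x, y) \<in> connected_rel A (induced_edges E A)"
      using xy 1 by (intro connected_rel_edge) auto
    then show ?thesis using f connected_rel_trans by (metis list.sel(1))
  qed
qed auto

text \<open>The Path condition bounds an inner edge by the larger of the two light end edges;
  otherwise \<open>{u, v}\<close> is itself the first or the last edge.\<close>

lemma path_condition_light:
  assumes pc: "path_condition N E w" and p: "is_path N E p"
    and s: "p = a # b # p'" "w {a, b} < c" and t: "p = q @ [s, t]" "w {s, t} < c"
    and m: "p = xs @ u # v # ys"
  shows "w {u, v} < c"
proof -
  have e: "path_edge p 0 = {a, b}" "path_edge p (length q) = {s, t}" "path_edge p (length xs) = {u, v}"
    using s(1) by (simp add: path_edge_def) (simp add: t(1) path_edge_def nth_append,
      simp add: m path_edge_def nth_append)
  have len: "length p = length q + 2" "length p = length xs + length ys + 2"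
    by (simp add: t(1), simp add: m)
  consider "length xs = 0" | "length xs = length q" | "0 < length xs" "length xs < length q"
    using len by linarith
  then show ?thesis
  proof cases
    case 3
    then have "w (path_edge p (length xs)) \<le> max (w (path_edge p 0)) (w (path_edge p (length q)))"
      using pc p len by (auto simp: path_condition_def)
    then show ?thesis using e s t by simp
  qed (use e s t in \<open>metis length_0_conv\<close>)+
qed

text \<open>Both descents end in a light edge. With the first one reversed and the two joined at
  \<open>x\<close>, they form a path whose first and last edges are light, so the edge
  \<open>{x, y}\<close> on it is light as well.\<close>

lemma opposite_descents_light:
  assumes pc: "path_condition N E w" and p: "is_path N E (rev (y # p) @ x # q)"
    and "descent E w c (x # y # p)" "descent E w c (x # q)"
  shows "w {x, y} < c"
proof -
  obtain p' u v where u: "x # y # p = p' @ [u, v]" "w {u, v} < c" using assms descent_last by metis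
  obtain q' s t where s: "x # q = q' @ [s, t]" "w {s, t} < c" using assms descent_last by metis
  have "rev (y # p) @ x # q = rev (x # y # p) @ q" by simp
  also have "\<dots> = v # u # rev p' @ q" unfolding u by simp
  finally have 1: "rev (y # p) @ x # q = v # u # rev p' @ q" .
  have "w {y, x} < c"
  proof (rule path_condition_light[OF pc p 1 _ _ s(2)])
    show "rev (y # p) @ x # q = (rev (y # p) @ q') @ [s, t]" using s by simp
    show "rev (y # p) @ x # q = rev p @ y # x # q" by simp
  qed (use u in \<open>simp add: insert_commute\<close>)
  then show ?thesis by (simp add: insert_commute)
qed

text \<open>By the Star condition the largest of the three weights occurs at least twice. If
  \<open>{x, z}\<close> were also lighter than \<open>{g, x}\<close>, the weight of
  \<open>{g, x}\<close> would be the only largest one.\<close>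

lemma star_condition_two_light:
  assumes "star_condition N E w" "x \<in> N" "{g, x} \<in> E" "{x, y} \<in> E" "{x, z} \<in> E"
    "g \<noteq> y" "g \<noteq> z" "y \<noteq> z" "w {x, y} < w {g, x}"
  shows "w {g, x} \<le> w {x, z}"
proof -
  have "{g, x} \<noteq> {x, y}" "{g, x} \<noteq> {x, z}" "{x, y} \<noteq> {x, z}"
    using assms by (auto simp: doubleton_eq_iff)
  then have "\<exists>f1 f2 f3. {f1, f2, f3} = {{g, x}, {x, y}, {x, z}} \<and> w f1 \<le> w f2 \<and> w f2 = w f3"
    by (intro assms(1)[unfolded star_condition_def, THEN bspec, OF assms(2), THEN bspec, OF assms(3),
      THEN bspec, OF assms(4), THEN bspec, OF assms(5), THEN mp]) simp
  then obtain f1 f2 f3 where f: "{f1, f2, f3} = {{g, x}, {x, y}, {x, z}}" "w f1 \<le> w f2" "w f2 = w f3"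
    by (elim exE conjE)
  have "{g, x} \<in> {f1, f2, f3}" "{x, y} \<in> {f1, f2, f3}" "{x, z} \<in> {f1, f2, f3}"
    unfolding f(1) by auto
  moreover have "{x, y} \<noteq> {x, z}" "{x, y} \<noteq> {g, x}"
    using assms(6,8) by (auto simp: doubleton_eq_iff)
  ultimately show ?thesis using f(2,3) assms(9) by (elim insertE emptyE) auto
qed

section \<open>Descents in a forest under both conditions\<close>

context
  fixes N :: "'a set" and E :: "'a set set" and w :: "'a set \<Rightarrow> real"
  assumes g: "finite_simple_graph N E" and cf: "cycle_free N E"
    and star: "star_condition N E w" and path: "path_condition N E w"
begin

text \<open>Where two descents part at \<open>x\<close>, each continuation is opposite to the other,
  so both next edges are lighter than \<open>c\<close>, hence lighter than \<open>{h, x}\<close>;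
  the Star condition forbids this. The bound \<open>c \<le> w {h, x}\<close> is inherited because a
  descent goes on only past edges of weight at least \<open>c\<close>.\<close>

lemma descent_unique:
  assumes "is_path N E (h # x # p)" "is_path N E (h # x # q)" "c \<le> w {h, x}"
    "descent E w c (x # p)" "descent E w c (x # q)"
  shows "p = q"
  using assms
proof (induction p arbitrary: h x q)
  case (Cons y p)
  obtain z q' where q: "q = z # q'" using Cons.prems by (cases q) auto
  have tl: "is_path N E (x # y # p)" "is_path N E (x # z # q')"
    using Cons.prems q by (auto simp: is_path_iff_successively)
  show ?case
  proof (cases "y = z")
    case True
    show ?thesis
    proof (cases "w {x, y} < c")
      case False
      then show ?thesis using Cons.IH[OF tl(1), of q'] tl(2) True q Cons.prems by auto
    qed (use Cons.prems True q in auto)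
  next
    case False
    have "w {x, y} < c"
      using cycle_free_join_paths[OF cf tl] False Cons.prems q
      by (intro opposite_descents_light[OF path, where p = p and q = q]) auto
    moreover have "w {x, z} < c"
      using cycle_free_join_paths[OF cf tl(2,1)] False Cons.prems q
      by (intro opposite_descents_light[OF path, where p = q' and q = "y # p"]) auto
    moreover have "w {h, x} \<le> w {x, z}" if "w {x, y} < w {h, x}"
      using Cons.prems q False that
      by (intro star_condition_two_light[OF star, of x h y z]) (auto simp: is_path_iff_successively)
    ultimately show ?thesis using Cons.prems(3) by linarith
  qed
qed simp

text \<open>The walk is turned into a path that begins with \<open>e\<close>, and is cut back at
  repeated vertices. The walk may cross \<open>e\<close> itself, so the orientation of
  \<open>e\<close> is left open.\<close>

lemma path_starting_with_edge:
  assumes e: "e \<in> induced_edges E A" and x: "x \<in> e"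
    and xy: "(x, y) \<in> connected_rel A (induced_edges E A)"
  shows "\<exists>a b p. e = {a, b} \<and> is_path A E (a # b # p) \<and> last (b # p) = y"
proof -
  have "card e = 2" using g e by (auto simp: finite_simple_graph_def induced_edges_def)
  then obtain x' where x': "e = {x, x'}" "x \<noteq> x'" using x by (auto simp: card_2_iff)
  have eA: "e \<in> E" "x \<in> A" "x' \<in> A" using e x' by (auto simp: induced_edges_def)
  have "(x, y) \<in> (adj A (induced_edges E A))\<^sup>*" using xy by (simp add: connected_rel_iff)
  then show ?thesis
  proof (induction rule: rtrancl_induct)
    case base
    show ?case using x' eA
      by (intro exI[of _ x'] exI[of _ x] exI[of _ "[]"])
        (auto simp: is_path_iff_successively insert_commute)
  next
    case (step y z)
    then obtain a b p where p: "e = {a, b}" "is_path A E (a # b # p)" "last (b # p) = y" by blast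
    have yz: "{y, z} \<in> E" "z \<in> A" using step.hyps by (auto simp: induced_edges_def)
    consider "z = a" | "z \<in> set (b # p)" | "z \<notin> set (a # b # p)" by auto
    then show ?case
    proof cases
      \<comment> \<open>The walk returns to the first vertex: the path restarts as \<open>e\<close>
        reversed.\<close>
      case 1
      then show ?thesis using p
        by (intro exI[of _ b] exI[of _ a] exI[of _ "[]"])
          (auto simp: is_path_iff_successively insert_commute)
    next
      case 2
      then obtain q r where "b # p = q @ z # r" by (meson split_list)
      then consider "z = b" "r = p" "q = []" | q' where "q = b # q'" "p = q' @ z # r"
        by (cases q) auto
      then show ?thesis
      proof cases
        case 1
        then show ?thesis using p
          by (intro exI[of _ a] exI[of _ b] exI[of _ "[]"])
            (auto simp: is_path_iff_successively)
      next
        case (2 q')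
        have "successively (\<lambda>u v. {u, v} \<in> E) ((a # b # q' @ [z]) @ r)"
          using p 2 by (simp add: is_path_iff_successively)
        then have "successively (\<lambda>u v. {u, v} \<in> E) (a # b # q' @ [z])"
          unfolding successively_append_iff by blast
        then show ?thesis using p 2
          by (intro exI[of _ a] exI[of _ b] exI[of _ "q' @ [z]"])
            (auto simp: is_path_iff_successively)
      qed
    next
      case 3
      have "successively (\<lambda>u v. {u, v} \<in> E) ((a # b # p) @ [z])"
        unfolding successively_append_iff using p yz by (auto simp: is_path_iff_successively)
      then show ?thesis using p yz 3
        by (intro exI[of _ a] exI[of _ b] exI[of _ "p @ [z]"])
          (auto simp: is_path_iff_successively)
    qed
  qed
qed

text \<open>The stretch of the path from \<open>z\<close> to \<open>y\<close>, closed by the edge,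
  would be a cycle if it had an inner vertex.\<close>

lemma cycle_free_edge_on_path:
  assumes p: "is_path N E p" and y: "last p = y" and z: "z \<in> set p" and yz: "{y, z} \<in> E"
  shows "\<exists>xs. p = xs @ [z, y]"
proof -
  have ne: "y \<noteq> z" using g yz by (auto simp: finite_simple_graph_def)
  obtain p1 r where r: "p = p1 @ z # r" using z by (meson split_list)
  have "r \<noteq> []" using r y ne by auto
  then obtain p2 where p2: "p = p1 @ z # p2 @ [y]" using r y by (cases r rule: rev_cases) auto
  have "p2 = []"
  proof (rule ccontr)
    assume "p2 \<noteq> []"
    moreover have "is_path N E (z # p2 @ [y])"
      using p unfolding p2 is_path_iff_successively by (auto simp: successively_append_iff)
    ultimately have "is_cycle N E (z # p2 @ [y])" using yz by (cases p2) (auto simp: is_cycle_def)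
    then show False using cf by (auto simp: cycle_free_def)
  qed
  then show ?thesis using p2 by auto
qed

lemma alive_descent:
  assumes A: "A \<subseteq> N" and e: "e \<in> alive E w A"
  shows "\<exists>a b p. e = {a, b} \<and> is_path A E (a # b # p) \<and> descent E w (w e) (a # b # p)"
proof -
  obtain f x y where f: "e \<in> induced_edges E A" "f \<in> induced_edges E A" "w f < w e" "x \<in> e" "y \<in> f"
    "(x, y) \<in> connected_rel A (induced_edges E A)"
    using e by (auto simp: alive_def)
  obtain a b p where p: "e = {a, b}" "is_path A E (a # b # p)" "last (b # p) = y"
    using path_starting_with_edge[OF f(1,4,6)] by blast
  have "card f = 2" using g f by (auto simp: finite_simple_graph_def induced_edges_def)
  then obtain z where z: "f = {y, z}" "y \<noteq> z" using f(5) by (auto simp: card_2_iff)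
  have yz: "{y, z} \<in> E" "z \<in> A" using z f(2) by (auto simp: induced_edges_def)
  \<comment> \<open>The path must traverse \<open>f\<close>, not merely reach its end
    \<open>y\<close>: either \<open>f\<close> is already its last edge, or \<open>z\<close> is
    appended.\<close>
  have "\<exists>p' xs u v ys. is_path A E (a # b # p') \<and> a # b # p' = xs @ u # v # ys \<and> {u, v} = f"
  proof (cases "z \<in> set (a # b # p)")
    case True
    have "is_path N E (a # b # p)" using p(2) A by (auto simp: is_path_iff_successively)
    then obtain xs where "a # b # p = xs @ [z, y]"
      using cycle_free_edge_on_path[of "a # b # p" y z] True p(3) yz(1) by auto
    then show ?thesis using p(2) z by (metis insert_commute)
  next
    case False
    have "successively (\<lambda>u v. {u, v} \<in> E) ((a # b # p) @ [z])"
      unfolding successively_append_iff using p yz by (auto simp: is_path_iff_successively)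
    then have "is_path A E (a # b # p @ [z])"
      using p yz False by (auto simp: is_path_iff_successively)
    moreover have "a # b # p @ [z] = (a # butlast (b # p)) @ y # z # []"
      using p(3) append_butlast_last_id[of "b # p"] by simp
    ultimately show ?thesis using z by blast
  qed
  then obtain p' xs u v ys where p': "is_path A E (a # b # p')" "a # b # p' = xs @ u # v # ys" "{u, v} = f"
    by blast
  have "successively (\<lambda>u v. {u, v} \<in> E) (a # b # p')" using p'(1) by (simp add: is_path_iff_successively)
  \<comment> \<open>Cutting after the first edge lighter than \<open>e\<close> gives the descent. It
    still begins with \<open>e\<close>, as every descent has at least two vertices.\<close>
  then obtain q s where q: "a # b # p' = q @ s" "descent E w (w e) q"
    using descent_prefix[OF _ p'(2), of E w "w e"] p'(3) f(3) by auto
  obtain q' where q': "q = a # b # q'" using q by (cases "(E, w, w e, q)" rule: descent.cases) auto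
  have "successively (\<lambda>u v. {u, v} \<in> E) q"
    using p'(1) unfolding q(1) is_path_iff_successively successively_append_iff by blast
  then have "is_path A E q" using p'(1) q' unfolding q(1) is_path_iff_successively by auto
  then show ?thesis using p(1) q q' by blast
qed

lemma descent_imp_alive:
  assumes "descent E w (w {a, b}) (a # b # p)" "set (a # b # p) \<subseteq> A"
  shows "{a, b} \<in> alive E w A"
  using descent_reaches_light_edge[OF assms] assms by (auto simp: alive_def induced_edges_def)

lemma alive_Int:
  assumes A: "A \<subseteq> N" and B: "B \<subseteq> N"
  shows "alive E w A \<inter> alive E w B \<subseteq> alive E w (A \<inter> B)"
proof
  fix e assume e: "e \<in> alive E w A \<inter> alive E w B"
  obtain a b p where p: "e = {a, b}" "is_path A E (a # b # p)" "descent E w (w e) (a # b # p)"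
    using alive_descent[OF A] e by blast
  obtain a' b' q where q: "e = {a', b'}" "is_path B E (a' # b' # q)" "descent E w (w e) (a' # b' # q)"
    using alive_descent[OF B] e by blast
  have pN: "is_path N E (a # b # p)" and qN: "is_path N E (a' # b' # q)"
    using p q A B by (auto simp: is_path_iff_successively)
  have dp: "descent E w (w e) (b # p)" and dq: "descent E w (w e) (b' # q)"
    using p q by auto
  consider "a' = a" "b' = b" | "a' = b" "b' = a" using p(1) q(1) by (auto simp: doubleton_eq_iff)
  then show "e \<in> alive E w (A \<inter> B)"
  proof cases
    \<comment> \<open>Both descents cross \<open>e\<close> in the same direction, so they coincide
      and lie in \<open>A \<inter> B\<close>.\<close>
    case 1
    have "p = q" using descent_unique[OF pN _ _ dp] qN dq 1 p(1) by auto
    then have "set (a # b # p) \<subseteq> A \<inter> B"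
      using p(2) q(2) 1 by (auto simp: is_path_iff_successively)
    then show ?thesis using descent_imp_alive p by blast
  next
    \<comment> \<open>The descents leave \<open>e\<close> through different ends. Joined, they would
      make \<open>e\<close> lighter than itself.\<close>
    case 2
    have "is_path N E (rev (a # q) @ b # p)"
    proof (rule cycle_free_join_paths[OF cf])
      show "is_path N E (b # a # q)" "is_path N E (b # p)"
        using pN qN 2 by (auto simp: is_path_iff_successively)
      show "a # q = [] \<or> p = [] \<or> hd (a # q) \<noteq> hd p"
        using pN by (cases p) (auto simp: is_path_iff_successively)
    qed
    then have "w {b, a} < w e"
      using q(3) dp 2 by (intro opposite_descents_light[OF path]) auto
    then show ?thesis using p(1) by (simp add: insert_commute)
  qed
qed

end


section \<open>Necessity of the conditions\<close>

text \<open>Only the component of \<open>a\<close> can contain \<open>a\<close>, so at most one term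
  is nonzero.\<close>

lemma sum_unanimity_components:
  assumes "finite A" "a \<in> A"
  shows "(\<Sum>C\<in>components A F. if {a, b} \<subseteq> C then 1 else 0 :: real)
    = (if (a, b) \<in> connected_rel A F then 1 else 0)"
proof -
  let ?Ca = "connected_rel A F `` {a}"
  have "(if {a, b} \<subseteq> C then 1 else 0 :: real) = (if C = ?Ca then (if b \<in> ?Ca then 1 else 0) else 0)"
    if C: "C \<in> components A F" for C
  proof -
    obtain x where x: "C = connected_rel A F `` {x}" using C by (auto simp: components_eq_image)
    have 1: "C = ?Ca" if "a \<in> C" using that x class_eq[of x a A F] by auto
    have 2: "a \<in> ?Ca" using assms(2) by (auto intro: connected_rel_refl)
    show ?thesis
    proof (cases "C = ?Ca")
      case True
      with 2 show ?thesis by (simp del: Image_singleton_iff)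
    next
      case False
      with 1 have "a \<notin> C" by blast
      with False show ?thesis by simp
    qed
  qed
  then have "(\<Sum>C\<in>components A F. if {a, b} \<subseteq> C then 1 else 0 :: real) =
    (\<Sum>C\<in>components A F. if C = ?Ca then (if b \<in> ?Ca then 1 else 0) else 0)"
    by (rule sum.cong[OF refl])
  also have "\<dots> = (if b \<in> ?Ca then 1 else 0)"
    using assms finite_components[OF assms(1)] by (simp add: components_eq_image)
  finally show ?thesis by simp
qed

lemma convex_unanimity_game:
  "S \<noteq> {} \<Longrightarrow> convex_game N (\<lambda>T. if S \<subseteq> T then 1 else 0)"
  by (auto simp: convex_game_def is_game_def)

text \<open>In the unanimity game of \<open>e\<close>, the restricted game has value 1 at
  \<open>A\<close> and at \<open>B\<close>, where the alive edge joins its own ends, and at most 1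
  at \<open>A \<union> B\<close>. If \<open>A \<inter> B\<close> were \<open>e\<close>, its value
  there would be 0, and convexity would give \<open>2 \<le> 1\<close>.\<close>

lemma alive_Int_ne_edge:
  assumes g: "finite_simple_graph N E"
    and conv: "\<forall>v. convex_game N v \<longrightarrow> convex_game N (restricted_game E w v)"
    and AB: "A \<subseteq> N" "B \<subseteq> N" and e: "e \<in> alive E w A" "e \<in> alive E w B"
  shows "A \<inter> B \<noteq> e"
proof
  assume int: "A \<inter> B = e"
  have fin: "finite N" using g by (simp add: finite_simple_graph_def)
  have eE: "e \<in> E" using e alive_subset by blast
  then have c2: "card e = 2" using g by (auto simp: finite_simple_graph_def)
  then obtain a b where ab: "e = {a, b}" "a \<noteq> b" by (auto simp: card_2_iff)
  define v where "v = (\<lambda>T. if {a, b} \<subseteq> T then 1 else 0 :: real)"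
  have "convex_game N v" unfolding v_def by (rule convex_unanimity_game) simp
  then have c: "restricted_game E w v A + restricted_game E w v B
    \<le> restricted_game E w v (A \<union> B) + restricted_game E w v (A \<inter> B)"
    using conv AB by (auto simp: convex_game_def)
  have val: "restricted_game E w v S = (if (a, b) \<in> connected_rel S (alive E w S) then 1 else 0)"
    if "S \<subseteq> N" "a \<in> S" for S
    unfolding restricted_game_def P_min_tilde_eq_components[OF g] v_def
    using sum_unanimity_components that fin finite_subset by metis
  have in_AB: "a \<in> A" "b \<in> A" "a \<in> B" "b \<in> B" using ab int by auto
  have "restricted_game E w v A = 1" "restricted_game E w v B = 1"
    using val AB in_AB e ab connected_rel_edge by metis+
  moreover have "restricted_game E w v (A \<union> B) \<le> 1" using val[of "A \<union> B"] AB in_AB by simp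
  moreover have "restricted_game E w v (A \<inter> B) = 0"
  proof -
    \<comment> \<open>On its own two ends, \<open>e\<close> is the only edge, so nothing lighter
      keeps it alive.\<close>
    have "induced_edges E e \<subseteq> {e}"
    proof
      fix f assume "f \<in> induced_edges E e"
      then have "f \<subseteq> e" "card f = 2" using g by (auto simp: induced_edges_def finite_simple_graph_def)
      then show "f \<in> {e}" using c2 by (metis card.infinite card_subset_eq singletonI zero_neq_numeral)
    qed
    then have "alive E w e = {}" by (auto simp: alive_def)
    then have "(a, b) \<notin> connected_rel e (alive E w e)" using ab by (auto simp: connected_rel_iff)
    then show ?thesis using val[of e] ab int AB by auto
  qed
  ultimately show False using c by simp
qed

text \<open>If \<open>f\<close> and \<open>h\<close> were both lighter than \<open>e\<close>, then
  \<open>e\<close> would be alive in \<open>f \<union> e\<close> and in \<open>h \<union> e\<close>,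
  which meet only in \<open>e\<close>.\<close>

lemma no_strict_max_at_vertex:
  assumes g: "finite_simple_graph N E"
    and conv: "\<forall>v. convex_game N v \<longrightarrow> convex_game N (restricted_game E w v)"
    and e: "e \<in> E" "f \<in> E" "h \<in> E" "x \<in> e" "x \<in> f" "x \<in> h" "f \<noteq> h" "e \<noteq> f" "e \<noteq> h"
    and lt: "w f < w e"
  shows "w e \<le> w h"
proof (rule ccontr)
  assume "\<not> w e \<le> w h"
  have alive: "e \<in> alive E w (d \<union> e)" if "d \<in> E" "x \<in> d" "w d < w e" for d
    using that e(1,4) unfolding alive_def induced_edges_def
    by (auto intro!: bexI[of _ d] bexI[of _ x] connected_rel_refl)
  have 2: "card e = 2" "card f = 2" "card h = 2" using g e by (auto simp: finite_simple_graph_def)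
  then obtain y z where y: "f = {x, y}" "h = {x, z}" using e by (auto simp: card_2_iff)
  have "(f \<union> e) \<inter> (h \<union> e) = e" using y e by auto
  moreover have "f \<union> e \<subseteq> N" "h \<union> e \<subseteq> N" using g e by (auto simp: finite_simple_graph_def)
  ultimately show False
    using alive_Int_ne_edge[OF g conv] alive e lt \<open>\<not> w e \<le> w h\<close> by (meson not_le)
qed

lemma star_condition_necessary:
  assumes g: "finite_simple_graph N E"
    and conv: "\<forall>v. convex_game N v \<longrightarrow> convex_game N (restricted_game E w v)"
  shows "star_condition N E w"
  unfolding star_condition_def
proof (intro ballI impI)
  fix x e1 e2 e3
  assume E: "e1 \<in> E" "e2 \<in> E" "e3 \<in> E"
    and "x \<in> e1 \<and> x \<in> e2 \<and> x \<in> e3 \<and> e1 \<noteq> e2 \<and> e1 \<noteq> e3 \<and> e2 \<noteq> e3"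
  then have x: "x \<in> e1" "x \<in> e2" "x \<in> e3" and ne: "e1 \<noteq> e2" "e1 \<noteq> e3" "e2 \<noteq> e3" by auto
  note m = no_strict_max_at_vertex[OF g conv]
  \<comment> \<open>Each edge in turn is the candidate for a strict maximum. As none is one, the
    largest weight occurs twice.\<close>
  have "w e2 < w e1 \<Longrightarrow> w e1 \<le> w e3" "w e1 < w e2 \<Longrightarrow> w e2 \<le> w e3" "w e1 < w e3 \<Longrightarrow> w e3 \<le> w e2"
    using m E x ne by metis+
  then consider "w e1 \<le> w e2" "w e2 = w e3" | "w e2 \<le> w e1" "w e1 = w e3" | "w e3 \<le> w e1" "w e1 = w e2"
    by linarith
  then show "\<exists>f1 f2 f3. {f1, f2, f3} = {e1, e2, e3} \<and> w f1 \<le> w f2 \<and> w f2 = w f3"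
    by cases (blast | metis insert_commute)+
qed

lemma path_nth_connected:
  assumes "is_path N E p" "m < length p" "i \<le> m" "(!) p ` {i..m} \<subseteq> S"
  shows "(p ! i, p ! m) \<in> connected_rel S (induced_edges E S)"
  using assms(3,2,4)
proof (induction m rule: dec_induct)
  case base
  then show ?case by (auto intro: connected_rel_refl)
next
  case (step m)
  have "p ! m \<in> S" "p ! Suc m \<in> S" using step by auto
  moreover have "{p ! m, p ! Suc m} \<in> E"
    using assms(1) step.prems by (auto simp: is_path_def path_edge_def)
  ultimately have "(p ! m, p ! Suc m) \<in> connected_rel S (induced_edges E S)"
    by (intro connected_rel_edge) (auto simp: induced_edges_def)
  moreover have "(p ! i, p ! m) \<in> connected_rel S (induced_edges E S)"
    using step.prems by (intro step.IH) (auto simp: image_subset_iff)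
  ultimately show ?case using connected_rel_trans by metis
qed

text \<open>If edge \<open>j\<close> were heavier than edges \<open>i\<close> and \<open>k\<close>,
  the first would keep it alive in the stretch from edge \<open>i\<close> to edge \<open>j\<close>,
  the second in the stretch from edge \<open>j\<close> to edge \<open>k\<close>. These stretches
  share exactly edge \<open>j\<close>.\<close>

lemma path_condition_necessary:
  assumes g: "finite_simple_graph N E"
    and conv: "\<forall>v. convex_game N v \<longrightarrow> convex_game N (restricted_game E w v)"
  shows "path_condition N E w"
  unfolding path_condition_def
proof (intro allI impI)
  fix p i j k
  assume "is_path N E p \<and> i < j \<and> j < k \<and> Suc k < length p"
  then have p: "is_path N E p" and ijk: "i < j" "j < k" "Suc k < length p" by auto
  \<comment> \<open>Edge \<open>l\<close> joins the vertices at positions \<open>l\<close> and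
    \<open>Suc l\<close>, hence the upper ends \<open>Suc j\<close> and
    \<open>Suc k\<close>.\<close>
  let ?A = "(!) p ` {i..Suc j}" and ?B = "(!) p ` {j..Suc k}"
  have edge: "path_edge p l \<in> E" if "Suc l < length p" for l using p that by (auto simp: is_path_def)
  have ind: "path_edge p l \<in> induced_edges E ((!) p ` {s..t})" if "s \<le> l" "Suc l \<le> t" "Suc l < length p" for l s t
    using edge that by (auto simp: induced_edges_def path_edge_def)
  show "w (path_edge p j) \<le> max (w (path_edge p i)) (w (path_edge p k))"
  proof (rule ccontr)
    assume *: "\<not> ?thesis"
    have "(p ! i, p ! j) \<in> connected_rel ?A (induced_edges E ?A)"
      using ijk by (intro path_nth_connected[OF p]) auto
    then have "(p ! j, p ! i) \<in> connected_rel ?A (induced_edges E ?A)" by (rule connected_rel_sym)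
    moreover have "p ! j \<in> path_edge p j" "p ! i \<in> path_edge p i" "p ! k \<in> path_edge p k"
      by (auto simp: path_edge_def)
    moreover have "(p ! j, p ! k) \<in> connected_rel ?B (induced_edges E ?B)"
      using ijk by (intro path_nth_connected[OF p]) auto
    moreover have "path_edge p j \<in> induced_edges E ?A" "path_edge p i \<in> induced_edges E ?A"
      "path_edge p j \<in> induced_edges E ?B" "path_edge p k \<in> induced_edges E ?B"
      by (rule ind; use ijk in linarith)+
    moreover have "w (path_edge p i) < w (path_edge p j)" "w (path_edge p k) < w (path_edge p j)"
      using * by auto
    ultimately have "path_edge p j \<in> alive E w ?A" "path_edge p j \<in> alive E w ?B"
      unfolding alive_def by blast+
    moreover have "?A \<subseteq> N" "?B \<subseteq> N" using p ijk by (auto simp: is_path_def)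
    moreover have "?A \<inter> ?B = path_edge p j"
    proof -
      \<comment> \<open>The vertices of a path are distinct, so the two stretches intersect as their
        index intervals do.\<close>
      have "inj_on ((!) p) {..<length p}" using p by (auto simp: is_path_def inj_on_nth)
      then have "?A \<inter> ?B = (!) p ` ({i..Suc j} \<inter> {j..Suc k})"
        using ijk by (intro inj_on_image_Int[symmetric]) auto
      also have "{i..Suc j} \<inter> {j..Suc k} = {j, Suc j}" using ijk by auto
      finally show ?thesis by (simp add: path_edge_def)
    qed
    ultimately show False using alive_Int_ne_edge[OF g conv] by metis
  qed
qed

theorem mainTheorem2:
  fixes N :: "'a set" and E :: "'a set set" and w :: "'a set \<Rightarrow> real"
  assumes "finite_simple_graph N E" and "cycle_free N E"
  shows "(\<forall>v. convex_game N v \<longrightarrow> convex_game N (restricted_game E w v)) \<longleftrightarrow>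
         star_condition N E w \<and> path_condition N E w"
proof
  assume "\<forall>v. convex_game N v \<longrightarrow> convex_game N (restricted_game E w v)"
  with assms(1) show "star_condition N E w \<and> path_condition N E w"
    by (intro conjI star_condition_necessary path_condition_necessary)
next
  assume "star_condition N E w \<and> path_condition N E w"
  then show "\<forall>v. convex_game N v \<longrightarrow> convex_game N (restricted_game E w v)"
    using restricted_game_convex[OF assms] alive_Int[OF assms] by blast
qed

end
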